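(* Let $\mathbf G=(J,V,E)$ be a CDAG and $A,B,C,D\subseteq J\,\dot\cup\,V$ subsets of nodes. Then the ternary relation $\perp\,=\,\perp^{\mathrm{id}}_{\mathbf G}$ (id-separation) satisfies the following rules: a) (Extended Left Redundancy) $A\subseteq C\implies A\perp B\mid C$. b) ($J$-Restricted Right Redundancy) $A\perp\emptyset\mid C\cup J$ always holds. c) (Left Decomposition) $A\cup D\perp B\mid C\implies D\perp B\mid C$. d) (Right Decomposition) $A\perp B\cup D\mid C\implies A\perp D\mid C$. e) ($J$-Inverted Right Decomposition) $A\perp B\mid C\implies A\perp J\cup B\mid C$. f) (Left Weak Union) $A\cup D\perp B\mid C\implies A\perp B\mid D\cup C$. g) (Right Weak Union) $A\perp B\cup D\mid C\implies A\perp B\mid D\cup C$. h) (Left Contraction) $(A\perp B\mid D\cup C)\land(D\perp B\mid C)\implies A\cup D\perp B\mid C$. i) (Right Contraction) $(A\perp B\mid D\cup C)\land(A\perp D\mid C)\implies A\perp B\cup D\mid C$. j) (Right Cross Contraction) $(A\perp B\mid D\cup C)\land(D\perp A\mid C)\implies A\perp B\cup D\mid C$. k) (Flipped Left Cross Contraction) $(A\perp B\mid D\cup C)\land(B\perp D\mid C)\implies B\perp A\cup D\mid C$.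
   Context: A conditional directed acyclic graph (CDAG) $\mathbf G=(J,V,E)$ consists of disjoint finite sets $J$ (input nodes) and $V$ (output nodes) and a set $E$ of directed edges $w\to v$ with $w\in J\cup V$, $v\in V$, such that the directed graph $(J\cup V,E)$ is acyclic. $\mathrm{Anc}^{\mathbf G}(C)$ is the set of nodes having a directed walk (possibly trivial) to some node in $C$. A walk $\pi$ is a finite sequence $v_0,\dots,v_n$ ($n\ge0$) of nodes together with, for each $k$, an edge of $\mathbf G$ between $v_{k-1}$ and $v_k$ in either direction; repetitions of nodes and edges are allowed. A position $k$ is a collider of $\pi$ if $0<k<n$ and $v_{k-1}\to v_k\leftarrow v_{k+1}$; all other positions, including both end nodes, are non-colliders. $\pi$ is d-blocked by $C$ if some non-collider of $\pi$ lies in $C$ or some collider of $\pi$ lies outside $\mathrm{Anc}^{\mathbf G}(C)$. For (not necessarily disjoint) sets of nodes, $A\perp^{d}_{\mathbf G}B\mid C$ means that every walk in $\mathbf G$ from a node in $A$ to a node in $B$ is d-blocked by $C$. Id-separation is $A\perp^{\mathrm{id}}_{\mathbf G}B\mid C:\iff A\perp^{d}_{\mathbf G}B\cup J\mid C$. *)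

theory Defs
  imports Main
begin

record 'a cdag_data =
  inputs :: "'a set"
  outputs :: "'a set"
  edges :: "('a \<times> 'a) set"

abbreviation nodes :: "'a cdag_data \<Rightarrow> 'a set" where
  "nodes G \<equiv> inputs G \<union> outputs G"

definition cdag :: "'a cdag_data \<Rightarrow> bool" where
  "cdag G \<longleftrightarrow>
     finite (inputs G) \<and> finite (outputs G) \<and> inputs G \<inter> outputs G = {} \<and>
     edges G \<subseteq> nodes G \<times> outputs G \<and> acyclic (edges G)"

definition Anc :: "'a cdag_data \<Rightarrow> 'a set \<Rightarrow> 'a set" where
  "Anc G C = {w \<in> nodes G. \<exists>v\<in>C. (w, v) \<in> (edges G)\<^sup>*}"

text \<open>
  A walk is represented by its non-empty list of nodes \<open>v\<^sub>0, \<dots>, v\<^sub>n\<close>. The edges need not be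
  recorded: by acyclicity there is at most one edge between two given nodes, in at most one
  of the two directions.
\<close>

definition walk :: "'a cdag_data \<Rightarrow> 'a list \<Rightarrow> bool" where
  "walk G p \<longleftrightarrow>
     p \<noteq> [] \<and> set p \<subseteq> nodes G \<and>
     (\<forall>k. Suc k < length p \<longrightarrow>
        (p ! k, p ! Suc k) \<in> edges G \<or> (p ! Suc k, p ! k) \<in> edges G)"

definition collider :: "'a cdag_data \<Rightarrow> 'a list \<Rightarrow> nat \<Rightarrow> bool" where
  "collider G p k \<longleftrightarrow>
     0 < k \<and> Suc k < length p \<and>
     (p ! (k - 1), p ! k) \<in> edges G \<and> (p ! Suc k, p ! k) \<in> edges G"

definition d_blocked :: "'a cdag_data \<Rightarrow> 'a list \<Rightarrow> 'a set \<Rightarrow> bool" where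
  "d_blocked G p C \<longleftrightarrow>
     (\<exists>k<length p. \<not> collider G p k \<and> p ! k \<in> C) \<or>
     (\<exists>k<length p. collider G p k \<and> p ! k \<notin> Anc G C)"

definition d_sep :: "'a cdag_data \<Rightarrow> 'a set \<Rightarrow> 'a set \<Rightarrow> 'a set \<Rightarrow> bool" where
  "d_sep G A B C \<longleftrightarrow> (\<forall>p. walk G p \<and> hd p \<in> A \<and> last p \<in> B \<longrightarrow> d_blocked G p C)"

definition id_sep :: "'a cdag_data \<Rightarrow> 'a set \<Rightarrow> 'a set \<Rightarrow> 'a set \<Rightarrow> bool" where
  "id_sep G A B C \<longleftrightarrow> d_sep G A (B \<union> inputs G) C"

end

theory Submission
  imports Defs
begin

text \<open>
  Since id-separation is d-separation with the input nodes added to the right-hand set, every rule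
  reduces to a property of d-separation: separation of a union on either side amounts to separation
  of both parts, symmetry (walks can be reversed), redundancy (an end node is a non-collider, so it
  blocks when it lies in the conditioning set), weak union (\<open>d_sep_weak_union\<close>) and contraction
  (\<open>d_sep_contraction\<close>). Right weak union, right contraction and both cross contractions then
  follow by symmetry. Id-separation itself is not symmetric, because the input nodes are added only
  on the right.

  The two substantial rules are proved contrapositively, by turning one open walk (one that is
  not d-blocked) into another.
  For contraction, an open walk given \<open>C\<close> that meets \<open>D\<close> at a non-collider can be cut there,
  which leaves an open walk that starts in \<open>D\<close>; if there is no such non-collider, the walk is also
  open given \<open>D \<union> C\<close>. For weak union, a walk that is open given \<open>D \<union> C\<close> can fail to be open
  given \<open>C\<close> only at a collider that is an ancestor of \<open>D\<close> but not of \<open>C\<close>. Cut the walk at the last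
  such collider and prepend the reversal of a directed path from there to \<open>D\<close>: the collider becomes a
  non-collider, and nothing on the directed path is in \<open>C\<close>, so the new walk from \<open>D\<close> is open.
\<close>

lemma not_d_blocked_iff:
  "\<not> d_blocked G p C \<longleftrightarrow>
     (\<forall>k<length p. if collider G p k then p ! k \<in> Anc G C else p ! k \<notin> C)"
  unfolding d_blocked_def by auto

lemma d_sep_open_walk:
  "\<lbrakk>d_sep G A B C; walk G p; hd p \<in> A; last p \<in> B; \<not> d_blocked G p C\<rbrakk> \<Longrightarrow> False"
  unfolding d_sep_def by blast

lemma Anc_mono: "C \<subseteq> C' \<Longrightarrow> Anc G C \<subseteq> Anc G C'"
  unfolding Anc_def by blast

lemma Anc_Un: "Anc G (D \<union> C) = Anc G D \<union> Anc G C"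
  unfolding Anc_def by blast

lemma self_in_Anc: "\<lbrakk>v \<in> C; v \<in> nodes G\<rbrakk> \<Longrightarrow> v \<in> Anc G C"
  unfolding Anc_def by blast

lemma parent_in_Anc: "\<lbrakk>(w, v) \<in> edges G; v \<in> Anc G C; w \<in> nodes G\<rbrakk> \<Longrightarrow> w \<in> Anc G C"
  unfolding Anc_def by (auto intro: converse_rtrancl_into_rtrancl)

lemma cdag_edge_nodes: "\<lbrakk>cdag G; (w, v) \<in> edges G\<rbrakk> \<Longrightarrow> w \<in> nodes G \<and> v \<in> nodes G"
  unfolding cdag_def by blast

lemma cdag_edge_asym: "\<lbrakk>cdag G; (w, v) \<in> edges G\<rbrakk> \<Longrightarrow> (v, w) \<notin> edges G"
  unfolding cdag_def acyclic_def by (meson r_into_trancl trancl_trans)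

section \<open>Operations on walks\<close>

lemma walk_nth_in_nodes: "\<lbrakk>walk G p; k < length p\<rbrakk> \<Longrightarrow> p ! k \<in> nodes G"
  unfolding walk_def using nth_mem by blast

lemma walk_rev:
  assumes "walk G p"
  shows "walk G (rev p)"
proof -
  have "(rev p ! k, rev p ! Suc k) \<in> edges G \<or> (rev p ! Suc k, rev p ! k) \<in> edges G"
    if k: "Suc k < length p" for k
  proof -
    let ?m = "length p - Suc (Suc k)"
    have "Suc ?m < length p" and "length p - Suc k = Suc ?m"
      using k by auto
    moreover have "rev p ! k = p ! Suc ?m" and "rev p ! Suc k = p ! ?m"
      using k by (auto simp: rev_nth Suc_diff_Suc)
    ultimately show ?thesis
      using assms unfolding walk_def by auto
  qed
  then show ?thesis
    using assms unfolding walk_def by auto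
qed

lemma collider_rev:
  assumes "k < length p"
  shows "collider G (rev p) k \<longleftrightarrow> collider G p (length p - Suc k)"
proof (cases "0 < k \<and> Suc k < length p")
  case True
  let ?m = "length p - Suc k"
  have "rev p ! (k - 1) = p ! Suc ?m" "rev p ! k = p ! ?m" "rev p ! Suc k = p ! (?m - 1)"
    using True by (auto simp: rev_nth Suc_diff_Suc)
  moreover have "0 < ?m \<and> Suc ?m < length p"
    using True by auto
  ultimately show ?thesis
    using True unfolding collider_def by auto
next
  case False
  then show ?thesis
    using assms unfolding collider_def by auto
qed

lemma d_blocked_rev_imp:
  assumes "d_blocked G (rev p) C"
  shows "d_blocked G p C"
proof -
  have *: "length p - Suc k < length p" "rev p ! k = p ! (length p - Suc k)"
    if "k < length p" for k
    using that by (auto simp: rev_nth)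
  show ?thesis
    using assms * unfolding d_blocked_def by (metis collider_rev length_rev)
qed

lemma walk_drop: "\<lbrakk>walk G p; k < length p\<rbrakk> \<Longrightarrow> walk G (drop k p)"
  unfolding walk_def by (auto dest: in_set_dropD)

text \<open>
  Only the cut position can change its status: it becomes an end node, hence a non-collider.
\<close>

lemma collider_drop:
  "k < length p \<Longrightarrow> collider G (drop k p) i \<longleftrightarrow> 0 < i \<and> collider G p (k + i)"
  unfolding collider_def by (cases i) auto

lemma open_drop:
  assumes k: "k < length p" and cut: "p ! k \<notin> C"
    and rest: "\<And>j. \<lbrakk>k < j; j < length p\<rbrakk> \<Longrightarrow>
      if collider G p j then p ! j \<in> Anc G C else p ! j \<notin> C"
  shows "\<not> d_blocked G (drop k p) C"
  unfolding not_d_blocked_iff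
proof (intro allI impI)
  fix i assume i: "i < length (drop k p)"
  show "if collider G (drop k p) i then drop k p ! i \<in> Anc G C else drop k p ! i \<notin> C"
  proof (cases "i = 0")
    case True
    then show ?thesis
      using k cut by (simp add: collider_drop)
  next
    case False
    then show ?thesis
      using k i rest[of "k + i"] by (simp add: collider_drop)
  qed
qed

text \<open>
  The old first node \<open>w\<close> does not become a collider, since the added edge leaves \<open>w\<close> and
  acyclicity excludes the opposite edge. It is not in \<open>C\<close>, because it was an end node of an open
  walk; so only the new first node \<open>v\<close> can block.
\<close>

lemma open_walk_Cons:
  assumes G: "cdag G" and e: "(w, v) \<in> edges G" and v: "v \<notin> C"
    and p: "walk G p" "hd p = w" "\<not> d_blocked G p C"
  shows "walk G (v # p) \<and> \<not> d_blocked G (v # p) C"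
proof
  have ne: "p \<noteq> []" and p0: "p ! 0 = w"
    using p(1,2) by (auto simp: walk_def hd_conv_nth)
  have adj: "((v # p) ! k, (v # p) ! Suc k) \<in> edges G \<or> ((v # p) ! Suc k, (v # p) ! k) \<in> edges G"
    if "Suc k < length (v # p)" for k
    using that e p0 p(1) unfolding walk_def by (cases k) auto
  show "walk G (v # p)"
    using adj p(1) cdag_edge_nodes[OF G e] unfolding walk_def by auto
  have collider_Suc: "collider G (v # p) (Suc k) \<longleftrightarrow> collider G p k" for k
    using cdag_edge_asym[OF G e] p0 unfolding collider_def by (cases k) auto
  show "\<not> d_blocked G (v # p) C"
    unfolding not_d_blocked_iff
  proof (intro allI impI)
    fix k assume "k < length (v # p)"
    then show "if collider G (v # p) k then (v # p) ! k \<in> Anc G C else (v # p) ! k \<notin> C"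
      using v p(3) unfolding not_d_blocked_iff
      by (cases k) (auto simp: collider_Suc, auto simp: collider_def)
  qed
qed

text \<open>
  The edges of the directed path from \<open>w\<close> to \<open>d\<close> are prepended one by one. No node on this path is in
  \<open>C\<close>, since otherwise \<open>w\<close> would be an ancestor of \<open>C\<close>.
\<close>

lemma open_walk_from_descendant:
  assumes G: "cdag G" and "(w, d) \<in> (edges G)\<^sup>*" and "w \<notin> Anc G C"
    and "walk G p" "hd p = w" "\<not> d_blocked G p C"
  shows "\<exists>q. walk G q \<and> hd q = d \<and> last q = last p \<and> \<not> d_blocked G q C"
  using assms(2-)
proof (induction arbitrary: p rule: converse_rtrancl_induct)
  case base
  then show ?case by blast
next
  case (step w v)
  have nodes: "w \<in> nodes G" "v \<in> nodes G"
    using cdag_edge_nodes[OF G step.hyps(1)] by auto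
  have v: "v \<notin> Anc G C"
    using parent_in_Anc[OF step.hyps(1)] nodes step.prems(1) by blast
  then have "v \<notin> C"
    using self_in_Anc nodes by metis
  then have "walk G (v # p) \<and> \<not> d_blocked G (v # p) C"
    using open_walk_Cons[OF G step.hyps(1)] step.prems by blast
  moreover have "last (v # p) = last p"
    using step.prems(2) unfolding walk_def by simp
  ultimately show ?case
    using step.IH[OF v, of "v # p"] by auto
qed

section \<open>Properties of d-separation\<close>

lemma d_sep_Un_left: "d_sep G (A \<union> D) B C \<longleftrightarrow> d_sep G A B C \<and> d_sep G D B C"
  unfolding d_sep_def by blast

lemma d_sep_sym:
  assumes "d_sep G A B C"
  shows "d_sep G B A C"
  unfolding d_sep_def
proof (intro allI impI)
  fix p assume p: "walk G p \<and> hd p \<in> B \<and> last p \<in> A"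
  then have "d_blocked G (rev p) C"
    using assms walk_rev[of G p] unfolding d_sep_def by (simp add: hd_rev last_rev)
  then show "d_blocked G p C"
    by (rule d_blocked_rev_imp)
qed

lemma d_sep_Un_right: "d_sep G A (B \<union> D) C \<longleftrightarrow> d_sep G A B C \<and> d_sep G A D C"
  unfolding d_sep_def by blast

lemma d_sep_left_redundancy:
  assumes "A \<subseteq> C"
  shows "d_sep G A B C"
  unfolding d_sep_def
proof (intro allI impI)
  fix p assume p: "walk G p \<and> hd p \<in> A \<and> last p \<in> B"
  then have "0 < length p" "p ! 0 \<in> C"
    using assms by (auto simp: walk_def hd_conv_nth)
  moreover have "\<not> collider G p 0"
    by (simp add: collider_def)
  ultimately show "d_blocked G p C"
    unfolding d_blocked_def by blast
qed

lemma d_sep_weak_union: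
  assumes G: "cdag G" and sep: "d_sep G (A \<union> D) B C"
  shows "d_sep G A B (D \<union> C)"
  unfolding d_sep_def
proof (intro allI impI, rule ccontr)
  fix p
  assume "walk G p \<and> hd p \<in> A \<and> last p \<in> B" and op: "\<not> d_blocked G p (D \<union> C)"
  then have p: "walk G p" "hd p \<in> A" "last p \<in> B"
    by auto
  have col: "p ! k \<in> Anc G (D \<union> C)" if "k < length p" "collider G p k" for k
    using op that unfolding not_d_blocked_iff by metis
  have noncol: "p ! k \<notin> D \<union> C" if "k < length p" "\<not> collider G p k" for k
    using op that unfolding not_d_blocked_iff by metis
  let ?bad = "{k. k < length p \<and> collider G p k \<and> p ! k \<notin> Anc G C}"
  show False
  proof (cases "?bad = {}")
    case True
    then have "\<not> d_blocked G p C"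
      using noncol unfolding not_d_blocked_iff by auto
    then show False
      using d_sep_open_walk[OF sep p(1)] p by blast
  next
    case False
    \<comment> \<open>With the last bad collider, every collider after the cut is an ancestor of \<open>C\<close>.\<close>
    have fin: "finite ?bad"
      by simp
    define k where "k = Max ?bad"
    have "k \<in> ?bad"
      unfolding k_def using Max_in[OF fin False] .
    then have k: "k < length p" "collider G p k" "p ! k \<notin> Anc G C"
      by auto
    have later: "p ! j \<in> Anc G C" if "k < j" "j < length p" "collider G p j" for j
      using Max_ge[OF fin, of j] that unfolding k_def by fastforce
    have "p ! k \<notin> C"
      using k self_in_Anc walk_nth_in_nodes[OF p(1) k(1)] by metis
    then have "\<not> d_blocked G (drop k p) C"
      using later noncol k(1) by (intro open_drop) auto
    moreover obtain d where d: "d \<in> D" "(p ! k, d) \<in> (edges G)\<^sup>*"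
      using col[OF k(1,2)] k(3) unfolding Anc_Un by (auto simp: Anc_def)
    ultimately obtain q where "walk G q" "hd q = d" "last q = last p" "\<not> d_blocked G q C"
      using open_walk_from_descendant[OF G d(2) k(3) walk_drop[OF p(1) k(1)]] k(1)
      by (auto simp: hd_drop_conv_nth)
    then show False
      using d_sep_open_walk[OF sep, of q] d(1) p(3) by simp
  qed
qed

lemma d_sep_contraction:
  assumes sepA: "d_sep G A B (D \<union> C)" and sepD: "d_sep G D B C"
  shows "d_sep G (A \<union> D) B C"
proof -
  have "d_sep G A B C"
    unfolding d_sep_def
  proof (intro allI impI, rule ccontr)
    fix p
    assume "walk G p \<and> hd p \<in> A \<and> last p \<in> B" and op: "\<not> d_blocked G p C"
    then have p: "walk G p" "hd p \<in> A" "last p \<in> B"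
      by auto
    show False
    proof (cases "\<exists>k<length p. \<not> collider G p k \<and> p ! k \<in> D")
      case True
      then obtain k where k: "k < length p" "\<not> collider G p k" "p ! k \<in> D"
        by blast
      then have "\<not> d_blocked G (drop k p) C"
        using op by (intro open_drop) (auto simp: not_d_blocked_iff)
      then show False
        using d_sep_open_walk[OF sepD walk_drop[OF p(1) k(1)]] k p(3)
        by (simp add: hd_drop_conv_nth)
    next
      case False
      then have "\<not> d_blocked G p (D \<union> C)"
        using op Anc_mono[of C "D \<union> C" G] unfolding not_d_blocked_iff by auto
      then show False
        using d_sep_open_walk[OF sepA] p by blast
    qed
  qed
  then show ?thesis
    using sepD by (simp add: d_sep_Un_left)
qed

lemma d_sep_weak_union_right:
  "\<lbrakk>cdag G; d_sep G A (B \<union> D) C\<rbrakk> \<Longrightarrow> d_sep G A B (D \<union> C)"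
  by (metis d_sep_sym d_sep_weak_union)

lemma d_sep_contraction_right:
  "\<lbrakk>d_sep G A B (D \<union> C); d_sep G A D C\<rbrakk> \<Longrightarrow> d_sep G A (B \<union> D) C"
  by (metis d_sep_sym d_sep_contraction)

section \<open>The rules of id-separation\<close>

theorem theorem5p10:
  fixes G :: "'a cdag_data" and A B C D :: "'a set"
  assumes "cdag G"
    and "A \<subseteq> nodes G" and "B \<subseteq> nodes G" and "C \<subseteq> nodes G" and "D \<subseteq> nodes G"
  shows "(A \<subseteq> C \<longrightarrow> id_sep G A B C)
    \<and> id_sep G A {} (C \<union> inputs G)
    \<and> (id_sep G (A \<union> D) B C \<longrightarrow> id_sep G D B C)
    \<and> (id_sep G A (B \<union> D) C \<longrightarrow> id_sep G A D C)
    \<and> (id_sep G A B C \<longrightarrow> id_sep G A (inputs G \<union> B) C)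
    \<and> (id_sep G (A \<union> D) B C \<longrightarrow> id_sep G A B (D \<union> C))
    \<and> (id_sep G A (B \<union> D) C \<longrightarrow> id_sep G A B (D \<union> C))
    \<and> (id_sep G A B (D \<union> C) \<and> id_sep G D B C \<longrightarrow> id_sep G (A \<union> D) B C)
    \<and> (id_sep G A B (D \<union> C) \<and> id_sep G A D C \<longrightarrow> id_sep G A (B \<union> D) C)
    \<and> (id_sep G A B (D \<union> C) \<and> id_sep G D A C \<longrightarrow> id_sep G A (B \<union> D) C)
    \<and> (id_sep G A B (D \<union> C) \<and> id_sep G B D C \<longrightarrow> id_sep G B (A \<union> D) C)"
proof (intro conjI impI; (elim conjE)?; unfold id_sep_def)
  let ?J = "inputs G"
  show "d_sep G A (B \<union> ?J) C" if "A \<subseteq> C"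
    using that by (rule d_sep_left_redundancy)
  show "d_sep G A ({} \<union> ?J) (C \<union> ?J)"
    by (intro d_sep_sym[OF d_sep_left_redundancy]) simp
  show "d_sep G D (B \<union> ?J) C" if "d_sep G (A \<union> D) (B \<union> ?J) C"
    using that by (simp add: d_sep_Un_left)
  show "d_sep G A (D \<union> ?J) C" if "d_sep G A (B \<union> D \<union> ?J) C"
    using that by (simp add: d_sep_Un_right)
  show "d_sep G A (?J \<union> B \<union> ?J) C" if "d_sep G A (B \<union> ?J) C"
    using that by (simp add: d_sep_Un_right)
  show "d_sep G A (B \<union> ?J) (D \<union> C)" if "d_sep G (A \<union> D) (B \<union> ?J) C"
    using assms(1) that by (rule d_sep_weak_union)
  show "d_sep G A (B \<union> ?J) (D \<union> C)" if "d_sep G A (B \<union> D \<union> ?J) C"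
    using assms(1) that by (intro d_sep_weak_union_right) (simp_all add: Un_ac)
  show "d_sep G (A \<union> D) (B \<union> ?J) C"
    if "d_sep G A (B \<union> ?J) (D \<union> C)" "d_sep G D (B \<union> ?J) C"
    using that by (rule d_sep_contraction)
  show "d_sep G A (B \<union> D \<union> ?J) C"
    if "d_sep G A (B \<union> ?J) (D \<union> C)" "d_sep G A (D \<union> ?J) C"
    using d_sep_contraction_right[OF that(1)] that(2) by (simp add: d_sep_Un_right)
  show "d_sep G A (B \<union> D \<union> ?J) C"
    if "d_sep G A (B \<union> ?J) (D \<union> C)" "d_sep G D (A \<union> ?J) C"
    using d_sep_contraction_right[OF that(1)] that(2) d_sep_sym[of G D A C]
    by (simp add: d_sep_Un_right)
  \<comment> \<open>The first premise, once reversed, has no \<open>J\<close> on its right-hand side; separation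
    of \<open>B\<close> from \<open>J\<close> comes from the second one.\<close>
  show "d_sep G B (A \<union> D \<union> ?J) C"
    if "d_sep G A (B \<union> ?J) (D \<union> C)" "d_sep G B (D \<union> ?J) C"
    using that d_sep_contraction_right[of G B A D C] d_sep_sym[of G A B "D \<union> C"]
    by (simp add: d_sep_Un_right)
qed

end
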